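(* Let $\varOmega\subset\mathbb{R}^d$ be an open set with finite Lebesgue measure $M>0$, let $\mu$ be the normalized Lebesgue measure on $\varOmega$, $d\mu(x)=\frac1M\,dx$, let $K\subset\mathbb{R}^l$ be compact, and let $u\colon\varOmega\to K$ be a Borel function. Let $\nu$ be a homogeneous Young measure, identified with a regular Borel probability measure on $K$. Then $\nu$ is associated with $u$ if and only if $\nu$ is the image of $\mu$ under $u$, that is, $\nu(A)=\mu(u^{-1}(A))$ for every Borel set $A\subseteq K$.
   Context: $\mathrm{rca}^1(K)$ denotes the set of regular Borel probability measures on $K$. A Young measure is a weakly$^\ast$ measurable mapping $\varOmega\ni x\mapsto\nu_x$ into the space $\mathrm{rca}(K)$ of regular countably additive scalar measures on $K$ with $\nu_x\in\mathrm{rca}^1(K)$ for a.e. $x$. It is homogeneous if this mapping is constant, and it is then identified with its single value $\nu\in\mathrm{rca}^1(K)$. A homogeneous Young measure $\nu$ is said to be associated with the function $u\colon\varOmega\to K$ if for every continuous function $\beta\colon K\to\mathbb{R}$ $$\int_K\beta(k)\,d\nu(k)=\int_{\varOmega}\beta(u(x))\,d\mu(x).$$ *)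

theory Defs
  imports "HOL-Analysis.Analysis" "HOL-Probability.Probability_Measure"
begin

text \<open>Elements of \<open>rca1 K\<close> live on the space \<open>K\<close> itself, so their measurable sets are exactly
  the Borel subsets of \<open>K\<close>; openness in the outer regularity is relative to \<open>K\<close>.\<close>

definition rca1 :: "'b::euclidean_space set \<Rightarrow> 'b measure set" where
  "rca1 K = {\<nu>. sets \<nu> = sets (restrict_space borel K) \<and> prob_space \<nu> \<and>
     (\<forall>A\<in>sets \<nu>.
        emeasure \<nu> A = (SUP C\<in>{C. compact C \<and> C \<subseteq> A}. emeasure \<nu> C) \<and>
        emeasure \<nu> A = (INF U\<in>{U. openin (top_of_set K) U \<and> A \<subseteq> U}. emeasure \<nu> U))}"

text \<open>Weak* measurability refers to the duality of \<open>rca(K)\<close> with \<open>C(K)\<close>. Only almost every value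
  of a Young measure has to be a probability measure. On the exceptional null set the values are
  irrelevant: \<open>lebesgue_on\<close> is complete, so they do not affect measurability. Hence signed
  measures are not needed, and the values are taken in the type of nonnegative measures.\<close>

definition young_measure ::
    "'a::euclidean_space set \<Rightarrow> 'b::euclidean_space set \<Rightarrow> ('a \<Rightarrow> 'b measure) \<Rightarrow> bool" where
  "young_measure \<Omega> K N \<longleftrightarrow>
     (\<forall>\<beta>::'b \<Rightarrow> real. continuous_on K \<beta> \<longrightarrow>
        (\<lambda>x. \<integral>k. \<beta> k \<partial>N x) \<in> borel_measurable (lebesgue_on \<Omega>)) \<and>
     (AE x in lebesgue_on \<Omega>. N x \<in> rca1 K)"

definition homogeneous_young_measure ::
    "'a::euclidean_space set \<Rightarrow> 'b::euclidean_space set \<Rightarrow> 'b measure \<Rightarrow> bool" where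
  "homogeneous_young_measure \<Omega> K \<nu> \<longleftrightarrow> young_measure \<Omega> K (\<lambda>_. \<nu>)"

text \<open>The domain of \<open>u\<close> is the space of \<open>\<mu>\<close>. A continuous \<open>\<beta> : K \<rightarrow> \<real>\<close> is a total function
  that is continuous on \<open>K\<close>; its values outside \<open>K\<close> do not enter the integrals when \<open>\<nu>\<close> has
  space \<open>K\<close> and \<open>u\<close> maps into \<open>K\<close>.\<close>

definition associated_with ::
    "'b::euclidean_space set \<Rightarrow> 'a measure \<Rightarrow> 'b measure \<Rightarrow> ('a \<Rightarrow> 'b) \<Rightarrow> bool" where
  "associated_with K \<mu> \<nu> u \<longleftrightarrow>
     (\<forall>\<beta>::'b \<Rightarrow> real. continuous_on K \<beta> \<longrightarrow> (\<integral>k. \<beta> k \<partial>\<nu>) = (\<integral>x. \<beta> (u x) \<partial>\<mu>))"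

end

theory Submission
  imports Defs
begin

text \<open>Both conditions say that \<open>\<nu>\<close> is the push-forward of \<open>\<mu>\<close> along \<open>u\<close>, one of them tested on
  continuous functions and the other on Borel sets. A finite Borel measure on a metric space is
  determined by its integrals of bounded continuous functions: the functions
  \<open>x \<mapsto> max 0 (1 - n \<cdot> dist(x, C))\<close> converge boundedly to the indicator of a closed set \<open>C\<close>, and the
  closed sets form an intersection-stable generator of the Borel sets.\<close>

text \<open>Off \<open>C\<close> the distance is positive by closedness, so the terms vanish from
  some index on. Nonemptiness matters because \<open>infdist x {}\<close> is 0 by convention, which
  would make every term 1.\<close>

lemma tendsto_indicator_closed:
  fixes C :: "'a::metric_space set"
  assumes "closed C" "C \<noteq> {}"
  shows "(\<lambda>n. max 0 (1 - real n * infdist x C)) \<longlonglongrightarrow> indicator C x"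
proof (cases "x \<in> C")
  case True
  then show ?thesis by simp
next
  case False
  then have pos: "infdist x C > 0"
    using assms in_closed_iff_infdist_zero[of C x] infdist_nonneg[of x C] by force
  obtain N where N: "inverse (infdist x C) < real N"
    using reals_Archimedean2 by blast
  have "max 0 (1 - real n * infdist x C) = 0" if "n \<ge> N" for n
  proof -
    have "inverse (infdist x C) < real n" using N that by linarith
    then have "1 < real n * infdist x C"
      using pos by (simp add: field_simps)
    then show ?thesis by simp
  qed
  then have "\<forall>\<^sub>F n in sequentially. max 0 (1 - real n * infdist x C) = 0"
    by (auto simp: eventually_sequentially)
  then show ?thesis using False by (simp add: tendsto_eventually)
qed

lemma finite_borel_measure_eqI_continuous:
  fixes M N :: "'a::metric_space measure"
  assumes "finite_measure M" "finite_measure N"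
    and sets: "sets M = sets borel" "sets N = sets borel"
    and eq: "\<And>f :: 'a \<Rightarrow> real. continuous_on UNIV f \<Longrightarrow> bounded (range f) \<Longrightarrow>
      (\<integral>x. f x \<partial>M) = (\<integral>x. f x \<partial>N)"
  shows "M = N"
proof -
  interpret M: finite_measure M by fact
  interpret N: finite_measure N by fact
  have closed_eq: "emeasure M C = emeasure N C" if C: "closed C" for C
  proof (cases "C = {}")
    case False
    define f where "f n x = max 0 (1 - real n * infdist x C)" for n x
    have cont: "continuous_on UNIV (f n)" for n
      unfolding f_def by (intro continuous_intros)
    have f01: "norm (f n x) \<le> 1" for n x
      by (simp add: f_def infdist_nonneg)
    \<comment> \<open>Stated for a generic \<open>L\<close>, so that it serves both measures and the
      conclusion follows from uniqueness of limits. The dominating constant 1 is integrable because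
      \<open>L\<close> is finite.\<close>
    have lim: "(\<lambda>n. \<integral>x. f n x \<partial>L) \<longlonglongrightarrow> measure L C"
      if "finite_measure L" and L: "sets L = sets borel" for L
    proof -
      interpret L: finite_measure L by fact
      have meas: "f n \<in> borel_measurable L" for n
        using cont borel_measurable_continuous_onI measurable_cong_sets[OF L refl] by blast
      have C_sets: "C \<in> sets L" using C L by simp
      have "(\<lambda>n. \<integral>x. f n x \<partial>L) \<longlonglongrightarrow> (\<integral>x. indicator C x \<partial>L)"
      proof (rule integral_dominated_convergence[where w = "\<lambda>_. 1"])
        show "AE x in L. (\<lambda>n. f n x) \<longlonglongrightarrow> indicator C x"
          unfolding f_def using tendsto_indicator_closed[OF C False] by simp
      qed (use meas f01 C_sets in auto)
      also have "(\<integral>x. indicator C x \<partial>L) = measure L C"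
        using sets.sets_into_space[OF C_sets] by (simp add: Int_absorb2)
      finally show ?thesis .
    qed
    have "(\<integral>x. f n x \<partial>M) = (\<integral>x. f n x \<partial>N)" for n
      using f01 by (intro eq cont) (auto simp: bounded_iff)
    then have "measure M C = measure N C"
      using LIMSEQ_unique[OF lim[OF assms(1) sets(1)]] lim[OF assms(2) sets(2)] by simp
    then show ?thesis
      by (simp add: M.emeasure_eq_measure N.emeasure_eq_measure)
  qed simp
  show ?thesis
  proof (rule measure_eqI_generator_eq[where E = "Collect closed" and \<Omega> = UNIV and A = "\<lambda>_. UNIV"])
    show "Int_stable (Collect closed :: 'a set set)"
      by (auto simp: Int_stable_def)
    show "sets M = sigma_sets UNIV (Collect closed)" "sets N = sigma_sets UNIV (Collect closed)"
      using sets by (simp_all add: borel_eq_closed)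
  qed (use closed_eq in auto)
qed

text \<open>Bridges the Borel function \<open>u\<close> and the Lebesgue sigma-algebra carrying
  \<mu>: a trace on \<open>S\<close> of a Borel set is also the trace of a Lebesgue set.\<close>

lemma measurable_lebesgue_on_of_borel:
  assumes "u \<in> measurable (restrict_space borel S) N"
  shows "u \<in> measurable (lebesgue_on S) N"
proof (rule measurableI)
  fix A assume "A \<in> sets N"
  then have "u -` A \<inter> space (restrict_space borel S) \<in> sets (restrict_space borel S)"
    using assms measurable_sets by blast
  then show "u -` A \<inter> space (lebesgue_on S) \<in> sets (lebesgue_on S)"
    by (auto simp: space_restrict_space sets_restrict_space)
qed (use measurable_space[OF assms] in \<open>simp add: space_restrict_space\<close>)

text \<open>For a constant map the condition required almost everywhere does not depend on the
  point, so a failure would occur on all of \<Omega> and make \<Omega> a null set.\<close>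

lemma homogeneous_young_measure_in_rca1:
  assumes "homogeneous_young_measure \<Omega> K \<nu>" "\<Omega> \<in> sets lebesgue" "emeasure lebesgue \<Omega> \<noteq> 0"
  shows "\<nu> \<in> rca1 K"
proof (rule ccontr)
  assume "\<nu> \<notin> rca1 K"
  then have "AE x in lebesgue_on \<Omega>. False"
    using assms(1) by (simp add: homogeneous_young_measure_def young_measure_def)
  then have "emeasure (lebesgue_on \<Omega>) (space (lebesgue_on \<Omega>)) = 0"
    using AE_iff_measurable[of "space (lebesgue_on \<Omega>)" "lebesgue_on \<Omega>" "\<lambda>_. False"] by auto
  then show False
    using assms by (simp add: space_restrict_space emeasure_restrict_space)
qed

text \<open>The uniqueness lemma concerns Borel measures on the whole space, whereas \<nu> lives on
  \<open>K\<close>. Hence \<nu> is first pushed forward along the inclusion of \<open>K\<close>. The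
  converse is the change of variables formula.\<close>

lemma associated_with_iff_distr:
  fixes K :: "'b::euclidean_space set"
  assumes "finite_measure \<mu>" "finite_measure \<nu>" and K: "K \<in> sets borel"
    and u: "u \<in> measurable \<mu> (restrict_space borel K)"
    and \<nu>: "sets \<nu> = sets (restrict_space borel K)"
  shows "associated_with K \<mu> \<nu> u \<longleftrightarrow> \<nu> = distr \<mu> (restrict_space borel K) u"
proof
  assume assoc: "associated_with K \<mu> \<nu> u"
  have id: "(\<lambda>k. k) \<in> measurable \<nu> borel"
    unfolding measurable_cong_sets[OF \<nu> refl] by (simp add: measurable_restrict_space1)
  have u_borel: "u \<in> borel_measurable \<mu>"
    using u by (simp add: measurable_restrict_space2_iff)
  have eq: "distr \<nu> borel (\<lambda>k. k) = distr \<mu> borel u"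
  proof (rule finite_borel_measure_eqI_continuous)
    fix f :: "'b \<Rightarrow> real"
    assume f: "continuous_on UNIV f"
    then have "(\<integral>k. f k \<partial>\<nu>) = (\<integral>x. f (u x) \<partial>\<mu>)"
      using assoc continuous_on_subset unfolding associated_with_def by blast
    then show "(\<integral>x. f x \<partial>distr \<nu> borel (\<lambda>k. k)) = (\<integral>x. f x \<partial>distr \<mu> borel u)"
      using f id u_borel by (simp add: integral_distr borel_measurable_continuous_onI)
  qed (use assms id u_borel in \<open>auto intro: finite_measure.finite_measure_distr\<close>)
  show "\<nu> = distr \<mu> (restrict_space borel K) u"
  proof (rule measure_eqI)
    fix A assume A: "A \<in> sets \<nu>"
    \<comment> \<open>As \<open>K\<close> is Borel, measurable subsets of \<open>K\<close> are Borel
      in the whole space, where \<open>eq\<close> can be evaluated on them.\<close>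
    then have "A \<in> sets borel"
      using \<nu> K by (simp add: sets_restrict_space_iff)
    then have "emeasure \<nu> A = emeasure (distr \<nu> borel (\<lambda>k. k)) A"
      using id sets.sets_into_space[OF A] by (simp add: emeasure_distr Int_absorb2)
    also have "\<dots> = emeasure (distr \<mu> (restrict_space borel K) u) A"
      using A \<nu> u u_borel \<open>A \<in> sets borel\<close> by (simp add: eq emeasure_distr)
    finally show "emeasure \<nu> A = emeasure (distr \<mu> (restrict_space borel K) u) A" .
  qed (simp add: \<nu>)
next
  assume "\<nu> = distr \<mu> (restrict_space borel K) u"
  then show "associated_with K \<mu> \<nu> u"
    \<comment> \<open>A test function is continuous only on \<open>K\<close>, hence measurable for
      \<open>restrict_space borel K\<close>, the target of the push-forward.\<close>
    using u by (simp add: associated_with_def integral_distr borel_measurable_continuous_on_restrict)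
qed

theorem theorem3p1:
  fixes \<Omega> :: "(real ^ 'd) set" and K :: "(real ^ 'l) set"
    and M :: real and \<mu> :: "(real ^ 'd) measure"
    and u :: "real ^ 'd \<Rightarrow> real ^ 'l" and \<nu> :: "(real ^ 'l) measure"
  assumes "open \<Omega>"
    and "emeasure lebesgue \<Omega> = ennreal M" and "M > 0"
    and "\<mu> = scale_measure (ennreal (1 / M)) (lebesgue_on \<Omega>)"
    and "compact K"
    and "u \<in> measurable (restrict_space borel \<Omega>) (restrict_space borel K)"
    and "homogeneous_young_measure \<Omega> K \<nu>"
  shows "associated_with K \<mu> \<nu> u \<longleftrightarrow>
    (\<forall>A. A \<in> sets borel \<and> A \<subseteq> K \<longrightarrow> emeasure \<nu> A = emeasure \<mu> (u -` A \<inter> \<Omega>))"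
proof -
  have \<Omega>: "\<Omega> \<in> sets lebesgue" using assms(1) by simp
  have K: "K \<in> sets borel" using assms(5) by (simp add: compact_imp_closed)
  have "\<nu> \<in> rca1 K"
    \<comment> \<open>Positivity of \<open>M\<close> is what makes \<Omega> non-null.\<close>
    using homogeneous_young_measure_in_rca1[OF assms(7) \<Omega>] assms(2,3) by simp
  then have \<nu>: "sets \<nu> = sets (restrict_space borel K)" and "prob_space \<nu>"
    by (auto simp: rca1_def)
  then have fin_\<nu>: "finite_measure \<nu>" by (simp add: prob_space.finite_measure)
  have space_\<mu>: "space \<mu> = \<Omega>" and sets_\<mu>: "sets \<mu> = sets (lebesgue_on \<Omega>)"
    using assms(4) by (simp_all add: space_scale_measure)
  have fin_\<mu>: "finite_measure \<mu>"
    using \<Omega> assms(2) space_\<mu>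
    by (intro finite_measureI)
      (simp add: assms(4) emeasure_restrict_space ennreal_mult_eq_top_iff)
  have u: "u \<in> measurable \<mu> (restrict_space borel K)"
    using measurable_lebesgue_on_of_borel[OF assms(6)] measurable_cong_sets[OF sets_\<mu> refl] by blast
  have "\<nu> = distr \<mu> (restrict_space borel K) u \<longleftrightarrow>
      (\<forall>A\<in>sets \<nu>. emeasure \<nu> A = emeasure (distr \<mu> (restrict_space borel K) u) A)"
    using measure_eqI[of \<nu> "distr \<mu> (restrict_space borel K) u"] \<nu> by auto
  \<comment> \<open>The members of \<open>sets \<nu>\<close> are exactly the Borel subsets of
    \<open>K\<close>, and the preimage is cut down to \<open>space \<mu>\<close>, which is
    \<Omega>.\<close>
  also have "\<dots> \<longleftrightarrow>
      (\<forall>A. A \<in> sets borel \<and> A \<subseteq> K \<longrightarrow> emeasure \<nu> A = emeasure \<mu> (u -` A \<inter> \<Omega>))"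
    using \<nu> K u space_\<mu> by (auto simp: sets_restrict_space_iff emeasure_distr)
  finally show ?thesis
    using associated_with_iff_distr[OF fin_\<mu> fin_\<nu> K u \<nu>] by blast
qed

end
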